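(* Let $M$ be a monoid containing a subgroup $\{x^k:k\in\mathbb Z\}$ isomorphic to $\mathbb Z$ (so $x^0$ is the identity of this subgroup). Suppose that $\rho$ is a congruence on the monoid $\mathcal S(M)$ satisfying the following conditions. (1) For all $m,n\in\mathbb Z$ with $m\neq n$, $(\{x^m\},x^0)$ is not $\rho$-related to $(\{x^n\},x^0)$. (2) For all $m,n>0$, $(\{x^m,x^{-n}\},x^0)$ is not $\rho$-related to $(\{x^m\},x^0)$ and is not $\rho$-related to $(\{x^{-n}\},x^0)$. (3) For all $m,n\ge0$ with $m\neq n$, $(\{x^m,x^n\},x^0)$ is not $\rho$-related to $(\{x^m\},x^0)$, and $(\{x^{-m},x^{-n}\},x^0)$ is not $\rho$-related to $(\{x^{-m}\},x^0)$. (4) For all $0<k<n$, $(\{x^0,x^n\},x^0)$ is not $\rho$-related to $(\{x^k\},x^0)$ and is not $\rho$-related to $(\{x^0,x^k,x^n\},x^0)$. (5) For all $0<k\le n$, $(\{x^0,x^n\},x^0)$ is not $\rho$-related to $(\{x^{-k}\},x^0)$ and is not $\rho$-related to $(\{x^{-k},x^0,x^n\},x^0)$. Then any monoid $S$ containing the quotient $Q=\mathcal S(M)/\rho$ as a subsemigroup is neither right coherent nor left coherent.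
   Context: For a monoid $M$, $\mathcal S(M)=\mathcal P(M)\rtimes M$ is the monoid with underlying set $\mathcal P(M)\times M$ ($\mathcal P(M)$ the power set of $M$), product $(X,x)(Y,y)=(X\cup xY,xy)$ where $xY=\{xy':y'\in Y\}$, and identity $(\emptyset,1)$. A right (left) $S$-act over a monoid $S$ is a set with a unital associative right (left) action of $S$. It is finitely presented if it is isomorphic to a quotient of a free act on a finite set by a finitely generated act congruence. $S$ is right (left) coherent if every finitely generated subact of every finitely presented right (left) $S$-act is finitely presented. *)

theory Defs
  imports "HOL-Algebra.Elementary_Groups"
begin

section \<open>The monoid S(M) and quotients by congruences\<close>

definition power_semidirect :: "('a, 'm) monoid_scheme \<Rightarrow> ('a set \<times> 'a) monoid" where
  "power_semidirect M =
    \<lparr>carrier = Pow (carrier M) \<times> carrier M,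
     monoid.mult = (\<lambda>(X, x) (Y, y). (X \<union> (x <#\<^bsub>M\<^esub> Y), x \<otimes>\<^bsub>M\<^esub> y)),
     one = ({}, \<one>\<^bsub>M\<^esub>)\<rparr>"

definition monoid_congruence :: "('a, 'm) monoid_scheme \<Rightarrow> ('a \<times> 'a) set \<Rightarrow> bool" where
  "monoid_congruence M \<rho> \<longleftrightarrow> equiv (carrier M) \<rho> \<and>
    (\<forall>(a, b) \<in> \<rho>. \<forall>(c, d) \<in> \<rho>. (a \<otimes>\<^bsub>M\<^esub> c, b \<otimes>\<^bsub>M\<^esub> d) \<in> \<rho>)"

text \<open>If \<open>\<rho>\<close> is a congruence, the product of the classes of \<open>a\<close> and \<open>b\<close> below is the class of
  \<open>a \<otimes> b\<close>.\<close>

definition quotient_monoid :: "('a, 'm) monoid_scheme \<Rightarrow> ('a \<times> 'a) set \<Rightarrow> 'a set monoid" where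
  "quotient_monoid M \<rho> =
    \<lparr>carrier = carrier M // \<rho>,
     monoid.mult = (\<lambda>A B. \<rho> `` (A <#>\<^bsub>M\<^esub> B)),
     one = \<rho> `` {\<one>\<^bsub>M\<^esub>}\<rparr>"


section \<open>Acts over a monoid\<close>

text \<open>An action of \<open>S\<close> on \<open>A\<close> is given by \<open>op\<close>, where \<open>op s a\<close> stands for \<open>a\<cdot>s\<close> in a
  right act and for \<open>s\<cdot>a\<close> in a left act.  Subacts, act congruences, quotients and isomorphisms
  only involve the unary maps \<open>op s\<close>, so they are shared by the two sides.  The empty act
  is allowed.\<close>

definition right_act ::
    "('s, 't) monoid_scheme \<Rightarrow> 'b set \<Rightarrow> ('s \<Rightarrow> 'b \<Rightarrow> 'b) \<Rightarrow> bool" where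
  "right_act S A op \<longleftrightarrow>
    (\<forall>s\<in>carrier S. \<forall>a\<in>A. op s a \<in> A) \<and>
    (\<forall>a\<in>A. op \<one>\<^bsub>S\<^esub> a = a) \<and>
    (\<forall>s\<in>carrier S. \<forall>t\<in>carrier S. \<forall>a\<in>A. op (s \<otimes>\<^bsub>S\<^esub> t) a = op t (op s a))"

definition left_act ::
    "('s, 't) monoid_scheme \<Rightarrow> 'b set \<Rightarrow> ('s \<Rightarrow> 'b \<Rightarrow> 'b) \<Rightarrow> bool" where
  "left_act S A op \<longleftrightarrow>
    (\<forall>s\<in>carrier S. \<forall>a\<in>A. op s a \<in> A) \<and>
    (\<forall>a\<in>A. op \<one>\<^bsub>S\<^esub> a = a) \<and>
    (\<forall>s\<in>carrier S. \<forall>t\<in>carrier S. \<forall>a\<in>A. op (s \<otimes>\<^bsub>S\<^esub> t) a = op s (op t a))"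

definition subact ::
    "('s, 't) monoid_scheme \<Rightarrow> 'b set \<Rightarrow> ('s \<Rightarrow> 'b \<Rightarrow> 'b) \<Rightarrow> 'b set \<Rightarrow> bool" where
  "subact S A op B \<longleftrightarrow> B \<subseteq> A \<and> (\<forall>s\<in>carrier S. \<forall>b\<in>B. op s b \<in> B)"

definition generated_subact ::
    "('s, 't) monoid_scheme \<Rightarrow> 'b set \<Rightarrow> ('s \<Rightarrow> 'b \<Rightarrow> 'b) \<Rightarrow> 'b set \<Rightarrow> 'b set" where
  "generated_subact S A op G = \<Inter> {B. subact S A op B \<and> G \<subseteq> B}"

definition fin_gen_subact ::
    "('s, 't) monoid_scheme \<Rightarrow> 'b set \<Rightarrow> ('s \<Rightarrow> 'b \<Rightarrow> 'b) \<Rightarrow> 'b set \<Rightarrow> bool" where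
  "fin_gen_subact S A op B \<longleftrightarrow>
    (\<exists>G. finite G \<and> G \<subseteq> A \<and> B = generated_subact S A op G)"

definition act_congruence ::
    "('s, 't) monoid_scheme \<Rightarrow> 'b set \<Rightarrow> ('s \<Rightarrow> 'b \<Rightarrow> 'b) \<Rightarrow> ('b \<times> 'b) set \<Rightarrow> bool" where
  "act_congruence S A op \<theta> \<longleftrightarrow> equiv A \<theta> \<and>
    (\<forall>s\<in>carrier S. \<forall>(a, b) \<in> \<theta>. (op s a, op s b) \<in> \<theta>)"

definition generated_act_congruence ::
    "('s, 't) monoid_scheme \<Rightarrow> 'b set \<Rightarrow> ('s \<Rightarrow> 'b \<Rightarrow> 'b) \<Rightarrow> ('b \<times> 'b) set \<Rightarrow> ('b \<times> 'b) set" where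
  "generated_act_congruence S A op R = \<Inter> {\<theta>. act_congruence S A op \<theta> \<and> R \<subseteq> \<theta>}"

definition quotient_op ::
    "('b \<times> 'b) set \<Rightarrow> ('s \<Rightarrow> 'b \<Rightarrow> 'b) \<Rightarrow> 's \<Rightarrow> 'b set \<Rightarrow> 'b set" where
  "quotient_op \<theta> op s C = \<theta> `` (op s ` C)"

definition act_iso ::
    "('s, 't) monoid_scheme \<Rightarrow> 'b set \<Rightarrow> ('s \<Rightarrow> 'b \<Rightarrow> 'b) \<Rightarrow> 'c set \<Rightarrow> ('s \<Rightarrow> 'c \<Rightarrow> 'c) \<Rightarrow> bool" where
  "act_iso S A op B op' \<longleftrightarrow>
    (\<exists>f. bij_betw f A B \<and> (\<forall>s\<in>carrier S. \<forall>a\<in>A. f (op s a) = op' s (f a)))"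

definition fin_gen_quotient ::
    "('s, 't) monoid_scheme \<Rightarrow> 'b set \<Rightarrow> ('s \<Rightarrow> 'b \<Rightarrow> 'b) \<Rightarrow> 'c set \<Rightarrow> ('s \<Rightarrow> 'c \<Rightarrow> 'c) \<Rightarrow> bool" where
  "fin_gen_quotient S A op F fop \<longleftrightarrow>
    (\<exists>R. finite R \<and> R \<subseteq> F \<times> F \<and>
      (let \<theta> = generated_act_congruence S F fop R
       in act_iso S A op (F // \<theta>) (quotient_op \<theta> fop)))"

text \<open>The free right (left) act on a set \<open>X\<close> is \<open>X \<times> S\<close> with \<open>S\<close> acting on the
  second component by right (left) multiplication.  Up to isomorphism, finite sets of natural
  numbers give all the free acts on finite sets.\<close>

definition fin_presented_right ::
    "('s, 't) monoid_scheme \<Rightarrow> 'b set \<Rightarrow> ('s \<Rightarrow> 'b \<Rightarrow> 'b) \<Rightarrow> bool" where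
  "fin_presented_right S A op \<longleftrightarrow> right_act S A op \<and>
    (\<exists>X :: nat set. finite X \<and>
      fin_gen_quotient S A op (X \<times> carrier S) (\<lambda>s (x, t). (x, t \<otimes>\<^bsub>S\<^esub> s)))"

definition fin_presented_left ::
    "('s, 't) monoid_scheme \<Rightarrow> 'b set \<Rightarrow> ('s \<Rightarrow> 'b \<Rightarrow> 'b) \<Rightarrow> bool" where
  "fin_presented_left S A op \<longleftrightarrow> left_act S A op \<and>
    (\<exists>X :: nat set. finite X \<and>
      fin_gen_quotient S A op (X \<times> carrier S) (\<lambda>s (x, t). (x, s \<otimes>\<^bsub>S\<^esub> t)))"

text \<open>A definition cannot quantify over all types, so the acts \<open>A\<close> range over the subsets
  of one type, chosen so that every finitely presented act is isomorphic to one of them.  The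
  lemmas \<open>right_coherentD\<close> and \<open>left_coherentD\<close> below show that the property then holds for
  acts on any type.\<close>

definition right_coherent :: "('s, 't) monoid_scheme \<Rightarrow> bool" where
  "right_coherent S \<longleftrightarrow>
    (\<forall>(A :: (nat \<times> 's) set set) op B.
      fin_presented_right S A op \<and> fin_gen_subact S A op B \<longrightarrow> fin_presented_right S B op)"

definition left_coherent :: "('s, 't) monoid_scheme \<Rightarrow> bool" where
  "left_coherent S \<longleftrightarrow>
    (\<forall>(A :: (nat \<times> 's) set set) op B.
      fin_presented_left S A op \<and> fin_gen_subact S A op B \<longrightarrow> fin_presented_left S B op)"


section \<open>Coherence does not depend on the type of the acts\<close>

lemma act_iso_sym:
  assumes "act_iso S A op B op'" and cl: "\<forall>s\<in>carrier S. \<forall>a\<in>A. op s a \<in> A"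
  shows "act_iso S B op' A op"
proof -
  obtain f where f: "bij_betw f A B" "\<forall>s\<in>carrier S. \<forall>a\<in>A. f (op s a) = op' s (f a)"
    using assms unfolding act_iso_def by blast
  have inv: "inv_into A f (f a) = a" if "a \<in> A" for a
    using f(1) that by (simp add: bij_betw_inv_into_left)
  have "inv_into A f (op' s b) = op s (inv_into A f b)" if s: "s \<in> carrier S" and "b \<in> B" for s b
  proof -
    obtain a where a: "a \<in> A" "b = f a"
      using f(1) \<open>b \<in> B\<close> by (auto simp: bij_betw_def)
    have "op' s b = f (op s a)" using f(2) a s by simp
    then show ?thesis using inv a cl s by simp
  qed
  then show ?thesis
    using bij_betw_inv_into[OF f(1)] unfolding act_iso_def by blast
qed

lemma act_iso_trans:
  assumes "act_iso S A op B op'" "act_iso S B op' C op''"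
  shows "act_iso S A op C op''"
proof -
  obtain f where f: "bij_betw f A B" "\<forall>s\<in>carrier S. \<forall>a\<in>A. f (op s a) = op' s (f a)"
    using assms unfolding act_iso_def by blast
  obtain g where g: "bij_betw g B C" "\<forall>s\<in>carrier S. \<forall>b\<in>B. g (op' s b) = op'' s (g b)"
    using assms unfolding act_iso_def by blast
  have "\<forall>s\<in>carrier S. \<forall>a\<in>A. (g \<circ> f) (op s a) = op'' s ((g \<circ> f) a)"
    using f g by (auto simp: bij_betw_def)
  then show ?thesis
    using bij_betw_trans[OF f(1) g(1)] unfolding act_iso_def by blast
qed

lemma right_act_iso:
  assumes S: "monoid S" and A: "right_act S A op" and "act_iso S A op B op'"
  shows "right_act S B op'"
proof -
  obtain f where f: "bij_betw f A B" "\<And>s a. s \<in> carrier S \<Longrightarrow> a \<in> A \<Longrightarrow> f (op s a) = op' s (f a)"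
    using assms unfolding act_iso_def by blast
  interpret monoid S by fact
  have B: "B = f ` A" using f(1) by (simp add: bij_betw_def)
  have cl: "op s a \<in> A" if "s \<in> carrier S" "a \<in> A" for s a
    using A that by (simp add: right_act_def)
  show ?thesis
    using A unfolding right_act_def B
    by (auto simp: f(2)[symmetric] cl)
qed

lemma left_act_iso:
  assumes S: "monoid S" and A: "left_act S A op" and "act_iso S A op B op'"
  shows "left_act S B op'"
proof -
  obtain f where f: "bij_betw f A B" "\<And>s a. s \<in> carrier S \<Longrightarrow> a \<in> A \<Longrightarrow> f (op s a) = op' s (f a)"
    using assms unfolding act_iso_def by blast
  interpret monoid S by fact
  have B: "B = f ` A" using f(1) by (simp add: bij_betw_def)
  have cl: "op s a \<in> A" if "s \<in> carrier S" "a \<in> A" for s a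
    using A that by (simp add: left_act_def)
  show ?thesis
    using A unfolding left_act_def B
    by (auto simp: f(2)[symmetric] cl)
qed

lemma fin_gen_quotient_iso:
  assumes "fin_gen_quotient S A op F fop" "act_iso S B op' A op"
  shows "fin_gen_quotient S B op' F fop"
proof -
  obtain R where "finite R" "R \<subseteq> F \<times> F"
    and R: "act_iso S A op (F // generated_act_congruence S F fop R)
      (quotient_op (generated_act_congruence S F fop R) fop)"
    using assms(1) unfolding fin_gen_quotient_def Let_def by blast
  then show ?thesis
    using act_iso_trans[OF assms(2) R] unfolding fin_gen_quotient_def Let_def by blast
qed

lemma fin_presented_right_iso:
  assumes "monoid S" "fin_presented_right S A op" "act_iso S A op B op'"
  shows "fin_presented_right S B op'"
proof -
  have "act_iso S B op' A op"
    using assms(2) act_iso_sym[OF assms(3)] by (simp add: fin_presented_right_def right_act_def)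
  note iso = fin_gen_quotient_iso[OF _ this]
  have "right_act S B op'"
    using assms(2) right_act_iso[OF assms(1) _ assms(3)] by (simp add: fin_presented_right_def)
  then show ?thesis
    using assms(2) iso unfolding fin_presented_right_def by blast
qed

lemma fin_presented_left_iso:
  assumes "monoid S" "fin_presented_left S A op" "act_iso S A op B op'"
  shows "fin_presented_left S B op'"
proof -
  have "act_iso S B op' A op"
    using assms(2) act_iso_sym[OF assms(3)] by (simp add: fin_presented_left_def left_act_def)
  note iso = fin_gen_quotient_iso[OF _ this]
  have "left_act S B op'"
    using assms(2) left_act_iso[OF assms(1) _ assms(3)] by (simp add: fin_presented_left_def)
  then show ?thesis
    using assms(2) iso unfolding fin_presented_left_def by blast
qed

lemma subact_generated_subact:
  assumes "\<forall>s\<in>carrier S. \<forall>a\<in>A. op s a \<in> A" "G \<subseteq> A"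
  shows "subact S A op (generated_subact S A op G)"
  using assms unfolding generated_subact_def subact_def by blast

lemma fin_gen_subact_imp_subact:
  assumes "\<forall>s\<in>carrier S. \<forall>a\<in>A. op s a \<in> A" "fin_gen_subact S A op B"
  shows "subact S A op B"
proof -
  obtain G where "G \<subseteq> A" "B = generated_subact S A op G"
    using assms(2) unfolding fin_gen_subact_def by blast
  then show ?thesis using subact_generated_subact[OF assms(1)] by simp
qed

lemma fin_gen_subact_iso:
  assumes cl: "\<forall>s\<in>carrier S. \<forall>a\<in>A. op s a \<in> A"
    and "act_iso S A op A' op'" "fin_gen_subact S A op B"
  obtains B' where "fin_gen_subact S A' op' B'" "act_iso S B op B' op'"
proof -
  obtain f where f: "bij_betw f A A'" "\<And>s a. s \<in> carrier S \<Longrightarrow> a \<in> A \<Longrightarrow> f (op s a) = op' s (f a)"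
    using assms unfolding act_iso_def by blast
  obtain G where G: "finite G" "G \<subseteq> A" "B = generated_subact S A op G"
    using assms unfolding fin_gen_subact_def by blast
  have B: "subact S A op B"
    using subact_generated_subact[OF cl G(2)] G(3) by simp
  have BA: "B \<subseteq> A" and Bcl: "\<And>s b. s \<in> carrier S \<Longrightarrow> b \<in> B \<Longrightarrow> op s b \<in> B"
    using B by (auto simp: subact_def)
  have A': "A' = f ` A" using f(1) by (simp add: bij_betw_def)
  have GB: "G \<subseteq> B" unfolding G(3) generated_subact_def by blast
  have 1: "subact S A' op' (f ` B)"
    unfolding subact_def A'
  proof (intro conjI ballI)
    fix s b assume "s \<in> carrier S" "b \<in> f ` B"
    then obtain c where c: "c \<in> B" "b = f c" by blast
    have "op' s b = f (op s c)" using f(2) c BA \<open>s \<in> carrier S\<close> by auto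
    then show "op' s b \<in> f ` B" using Bcl c \<open>s \<in> carrier S\<close> by auto
  qed (use BA in auto)
  have 2: "f ` B \<subseteq> C" if C: "subact S A' op' C" "f ` G \<subseteq> C" for C
  proof -
    have "subact S A op {a \<in> A. f a \<in> C}"
      using C(1) cl unfolding subact_def by (auto simp: f(2))
    then have "B \<subseteq> {a \<in> A. f a \<in> C}"
      unfolding G(3) generated_subact_def using C(2) G(2) by blast
    then show ?thesis by blast
  qed
  have "generated_subact S A' op' (f ` G) = f ` B"
    unfolding generated_subact_def using 1 2 GB by blast
  then have "fin_gen_subact S A' op' (f ` B)"
    unfolding fin_gen_subact_def using G A' by (metis finite_imageI image_mono)
  moreover have "act_iso S B op (f ` B) op'"
    unfolding act_iso_def
    using f BA by (intro exI[of _ f]) (auto simp: bij_betw_def intro: inj_on_subset)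
  ultimately show thesis by (rule that)
qed

lemma right_coherentD:
  assumes S: "monoid S" and coh: "right_coherent S"
    and A: "fin_presented_right S (A :: 'b set) op" and B: "fin_gen_subact S A op B"
  shows "fin_presented_right S B op"
proof -
  obtain A' :: "(nat \<times> 'a) set set" and op' where A': "act_iso S A op A' op'"
    using A unfolding fin_presented_right_def fin_gen_quotient_def Let_def by blast
  have act: "\<forall>s\<in>carrier S. \<forall>a\<in>A. op s a \<in> A"
    using A by (simp add: fin_presented_right_def right_act_def)
  obtain B' where B': "fin_gen_subact S A' op' B'" "act_iso S B op B' op'"
    using fin_gen_subact_iso[OF act A' B] .
  have "fin_presented_right S B' op'"
    using coh fin_presented_right_iso[OF S A A'] B' unfolding right_coherent_def by blast
  moreover have "act_iso S B' op' B op"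
    using act_iso_sym[OF B'(2)] fin_gen_subact_imp_subact[OF act B] by (simp add: subact_def)
  ultimately show ?thesis by (rule fin_presented_right_iso[OF S])
qed

lemma left_coherentD:
  assumes S: "monoid S" and coh: "left_coherent S"
    and A: "fin_presented_left S (A :: 'b set) op" and B: "fin_gen_subact S A op B"
  shows "fin_presented_left S B op"
proof -
  obtain A' :: "(nat \<times> 'a) set set" and op' where A': "act_iso S A op A' op'"
    using A unfolding fin_presented_left_def fin_gen_quotient_def Let_def by blast
  have act: "\<forall>s\<in>carrier S. \<forall>a\<in>A. op s a \<in> A"
    using A by (simp add: fin_presented_left_def left_act_def)
  obtain B' where B': "fin_gen_subact S A' op' B'" "act_iso S B op B' op'"
    using fin_gen_subact_iso[OF act A' B] .
  have "fin_presented_left S B' op'"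
    using coh fin_presented_left_iso[OF S A A'] B' unfolding left_coherent_def by blast
  moreover have "act_iso S B' op' B op"
    using act_iso_sym[OF B'(2)] fin_gen_subact_imp_subact[OF act B] by (simp add: subact_def)
  ultimately show ?thesis by (rule fin_presented_left_iso[OF S])
qed

end

theory Submission
  imports Defs
begin

text \<open>Write \<open>U k\<close> for the image in \<open>S\<close> of the class of \<open>(\<emptyset>, x\<^sup>k)\<close>, \<open>g\<close> for that of
  \<open>({x\<^sup>0}, x\<^sup>0)\<close>, and \<open>E k = U k g U (- k)\<close>, the image of the class of \<open>({x\<^sup>k}, x\<^sup>0)\<close>.  The
  \<open>U k\<close> form a copy of a quotient of the integers acting on \<open>S\<close> from the left, and the \<open>E k\<close>
  are commuting idempotents which this action shifts.

  Let \<open>\<theta>\<close> be the right congruence on \<open>S\<close> generated by the single pair \<open>(U 0, U 1)\<close>; it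
  identifies the elements of each orbit of the left action of the \<open>U k\<close> on \<open>U 0 S\<close>.  The subact of \<open>S / \<theta>\<close>
  generated by the class of \<open>g\<close> is \<open>S\<close> modulo the annihilator of this class, and \<open>(s, t)\<close> lies
  in the annihilator if and only if \<open>g t = U k (g s)\<close> for some \<open>k\<close>.  Let \<open>r N\<close> be the part of the
  annihilator obtained from chains that lead from \<open>g s\<close> to \<open>g t\<close>, stay in the right ideal
  \<open>g S\<close>, and use only multiplications by \<open>U l\<close> with \<open>\<bar>l\<bar> \<le> N\<close>.  The \<open>r N\<close> are an increasing
  sequence of right congruences with union the annihilator, so if the subact were finitely
  presented then the sequence would be stationary (\<open>right_coherent_annihilator_chain\<close>).

  It is not.  For \<open>k > N\<close>, the element \<open>y = E 0 E k\<close> of \<open>g S\<close> is sent into \<open>g S\<close> by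
  \<open>U (- k)\<close>.  A shift by \<open>U (- j)\<close> keeps \<open>y\<close> in \<open>g S\<close> only if \<open>E j y = y\<close>, that is, if
  \<open>{x\<^sup>0, x\<^sup>k}\<close> and \<open>{x\<^sup>j, x\<^sup>0, x\<^sup>k}\<close>, each paired with \<open>x\<^sup>0\<close>, are \<open>\<rho>\<close>-related.  The
  hypotheses on \<open>\<rho>\<close> exclude this for \<open>j = - k\<close> and for \<open>0 < \<bar>j\<bar> < k\<close>.  Hence no step of length
  at most \<open>N\<close> leads from \<open>y\<close> to another element (\<open>bounded_step_isolated\<close>), whereas \<open>U (- k) y\<close> differs from
  \<open>y\<close>.  The contradiction is an equation between elements coming from \<open>\<S>(M)\<close>, which is why
  \<open>S\<close> may be any monoid that contains the quotient.

  The data \<open>U\<close>, \<open>g\<close> have a left-right symmetry: in the opposite monoid, \<open>k \<mapsto> U (- k)\<close> and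
  \<open>g\<close> satisfy the same conditions.  So the left case is the right case for the opposite
  monoid.\<close>

section \<open>Quotient acts and cyclic subacts\<close>

lemma act_congruenceI:
  assumes "equiv A \<theta>"
    and "\<And>s a b. s \<in> carrier S \<Longrightarrow> (a, b) \<in> \<theta> \<Longrightarrow> (op s a, op s b) \<in> \<theta>"
  shows "act_congruence S A op \<theta>"
  using assms by (auto simp: act_congruence_def)

lemma act_congruenceD:
  assumes "act_congruence S A op \<theta>" "s \<in> carrier S" "(a, b) \<in> \<theta>"
  shows "(op s a, op s b) \<in> \<theta>"
  using assms by (auto simp: act_congruence_def)

lemma act_congruence_class:
  assumes "act_congruence S F fop \<theta>" "s \<in> carrier S" "a \<in> F"
  shows "quotient_op \<theta> fop s (\<theta> `` {a}) = \<theta> `` {fop s a}"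
proof -
  have eq: "equiv F \<theta>" and cl: "\<And>u v. (u, v) \<in> \<theta> \<Longrightarrow> (fop s u, fop s v) \<in> \<theta>"
    using assms unfolding act_congruence_def by auto
  have aa: "(a, a) \<in> \<theta>" using eq assms(3) by (simp add: equiv_def refl_on_def)
  have "z \<in> quotient_op \<theta> fop s (\<theta> `` {a}) \<longleftrightarrow> z \<in> \<theta> `` {fop s a}" for z
  proof -
    have "(fop s u, z) \<in> \<theta> \<longleftrightarrow> (fop s a, z) \<in> \<theta>" if "(a, u) \<in> \<theta>" for u
      using cl[OF that] eq unfolding equiv_def sym_def trans_def by blast
    moreover have "z \<in> quotient_op \<theta> fop s (\<theta> `` {a}) \<longleftrightarrow> (\<exists>u. (a, u) \<in> \<theta> \<and> (fop s u, z) \<in> \<theta>)"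
      by (auto simp: quotient_op_def)
    ultimately show ?thesis using aa by blast
  qed
  then show ?thesis by blast
qed

lemma right_act_quotient:
  assumes "monoid S" and act: "right_act S F fop" and cong: "act_congruence S F fop \<theta>"
  shows "right_act S (F // \<theta>) (quotient_op \<theta> fop)"
proof -
  interpret monoid S by fact
  show ?thesis
    using act unfolding right_act_def
    by (auto elim!: quotientE simp: act_congruence_class[OF cong] intro!: quotientI)
qed

lemma act_congruence_generated:
  assumes "R \<subseteq> F \<times> F" and "\<And>s a. s \<in> carrier S \<Longrightarrow> a \<in> F \<Longrightarrow> fop s a \<in> F"
  shows "act_congruence S F fop (generated_act_congruence S F fop R)"
proof -
  have top: "act_congruence S F fop (F \<times> F)"
    using assms(2) by (auto simp: act_congruence_def equiv_def refl_on_def sym_def trans_def)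
  let ?C = "{\<theta>. act_congruence S F fop \<theta> \<and> R \<subseteq> \<theta>}"
  have "F \<times> F \<in> ?C" using top assms(1) by blast
  have eq: "refl_on F \<theta>" "sym \<theta>" "trans \<theta>" if "\<theta> \<in> ?C" for \<theta>
    using that by (auto simp: act_congruence_def equiv_def)
  show ?thesis
    unfolding generated_act_congruence_def
  proof (rule act_congruenceI)
    show "equiv F (\<Inter> ?C)"
    proof (rule equivI)
      show "\<Inter> ?C \<subseteq> F \<times> F" using \<open>F \<times> F \<in> ?C\<close> by blast
      show "refl_on F (\<Inter> ?C)"
        using eq(1) unfolding refl_on_def by blast
      show "sym (\<Inter> ?C)"
        by (rule symI) (use eq(2) in \<open>blast dest: symD\<close>)
      show "trans (\<Inter> ?C)"
        by (rule transI) (use eq(3) in \<open>blast dest: transD\<close>)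
    qed
  qed (auto dest: act_congruenceD)
qed

lemma generated_subact_singleton:
  assumes "monoid S" and act: "right_act S A op" and b: "b \<in> A"
  shows "generated_subact S A op {b} = (\<lambda>s. op s b) ` carrier S"
proof -
  interpret monoid S by fact
  have "subact S A op ((\<lambda>s. op s b) ` carrier S)"
    unfolding subact_def
  proof (intro conjI ballI)
    fix s c assume "s \<in> carrier S" "c \<in> (\<lambda>s. op s b) ` carrier S"
    then obtain t where "t \<in> carrier S" "c = op t b" by blast
    then have "op s c = op (t \<otimes>\<^bsub>S\<^esub> s) b" "t \<otimes>\<^bsub>S\<^esub> s \<in> carrier S"
      using act b \<open>s \<in> carrier S\<close> by (auto simp: right_act_def)
    then show "op s c \<in> (\<lambda>s. op s b) ` carrier S" by blast
  qed (use act b in \<open>auto simp: right_act_def\<close>)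
  moreover have "b \<in> (\<lambda>s. op s b) ` carrier S"
    using act b by (auto simp: right_act_def intro!: image_eqI[of _ _ "\<one>\<^bsub>S\<^esub>"])
  moreover have "(\<lambda>s. op s b) ` carrier S \<subseteq> B" if "subact S A op B" "{b} \<subseteq> B" for B
    using that unfolding subact_def by auto
  ultimately show ?thesis unfolding generated_subact_def by blast
qed


section \<open>Annihilators in coherent monoids\<close>

abbreviation right_congruence :: "('s, 't) monoid_scheme \<Rightarrow> ('s \<times> 's) set \<Rightarrow> bool" where
  "right_congruence S \<equiv> act_congruence S (carrier S) (\<lambda>s t. t \<otimes>\<^bsub>S\<^esub> s)"

text \<open>A compactness argument: a finite presentation involves only finitely many pairs of the
  annihilator of the generator \<open>b\<close>, once its generators are written as multiples of \<open>b\<close> and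
  \<open>b\<close> is written in terms of them.  All these pairs lie in one \<open>r N\<close>, and they generate the
  annihilator.\<close>

lemma fin_presented_right_cyclic_chain:
  fixes S :: "('s, 't) monoid_scheme"
  assumes "monoid S" and fp: "fin_presented_right S B op"
    and b: "b \<in> B" "B = (\<lambda>s. op s b) ` carrier S"
    and r: "\<And>N. right_congruence S (r N)" and "mono r"
    and ann: "(\<Union>N :: nat. r N) = {(s, t) \<in> carrier S \<times> carrier S. op s b = op t b}"
  obtains N where "(\<Union>N. r N) = r N"
proof -
  interpret monoid S by fact
  define fop where "fop = (\<lambda>s (x :: nat, t). (x, t \<otimes>\<^bsub>S\<^esub> s))"
  have act: "right_act S B op" using fp by (simp add: fin_presented_right_def)
  obtain X R where "finite R" and RF: "R \<subseteq> (X \<times> carrier S) \<times> (X \<times> carrier S)"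
    and iso: "act_iso S B op
      ((X \<times> carrier S) // generated_act_congruence S (X \<times> carrier S) fop R)
      (quotient_op (generated_act_congruence S (X \<times> carrier S) fop R) fop)"
    using fp unfolding fin_presented_right_def fin_gen_quotient_def Let_def fop_def by blast
  define F where "F = X \<times> carrier S"
  define \<theta> where "\<theta> = generated_act_congruence S F fop R"
  obtain f where f: "bij_betw f B (F // \<theta>)"
      "\<And>s a. s \<in> carrier S \<Longrightarrow> a \<in> B \<Longrightarrow> f (op s a) = quotient_op \<theta> fop s (f a)"
    using iso unfolding act_iso_def F_def[symmetric] \<theta>_def[symmetric] by blast
  have cong: "act_congruence S F fop \<theta>"
    unfolding \<theta>_def by (rule act_congruence_generated) (use RF in \<open>auto simp: F_def fop_def\<close>)
  then have eq: "equiv F \<theta>" by (simp add: act_congruence_def)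
  have "\<exists>c\<in>carrier S. f (op c b) = \<theta> `` {(x, \<one>\<^bsub>S\<^esub>)}" if "x \<in> X" for x
  proof -
    have "\<theta> `` {(x, \<one>\<^bsub>S\<^esub>)} \<in> f ` B"
      using that f(1) by (auto simp: bij_betw_def F_def intro: quotientI)
    then show ?thesis using b(2) by auto
  qed
  then obtain c where c: "\<And>x. x \<in> X \<Longrightarrow> c x \<in> carrier S"
      "\<And>x. x \<in> X \<Longrightarrow> f (op (c x) b) = \<theta> `` {(x, \<one>\<^bsub>S\<^esub>)}"
    by metis
  \<comment> \<open>\<open>h\<close> lifts the presentation of \<open>B\<close> to a homomorphism from the free act to \<open>S\<close>.\<close>
  define h where "h = (\<lambda>(x, t). c x \<otimes>\<^bsub>S\<^esub> t)"
  have hS: "h q \<in> carrier S" if "q \<in> F" for q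
    using that c by (auto simp: h_def F_def)
  have fh: "f (op (h q) b) = \<theta> `` {q}" if "q \<in> F" for q
  proof -
    obtain x t where q: "q = (x, t)" "x \<in> X" "t \<in> carrier S" using \<open>q \<in> F\<close> unfolding F_def by blast
    have "op (h q) b = op t (op (c x) b)" "op (c x) b \<in> B"
      using act b(1) c(1) q by (simp_all add: right_act_def h_def)
    then have "f (op (h q) b) = quotient_op \<theta> fop t (\<theta> `` {(x, \<one>\<^bsub>S\<^esub>)})"
      using f(2) c(2) q by simp
    then show ?thesis
      using act_congruence_class[OF cong, of t "(x, \<one>\<^bsub>S\<^esub>)"] q by (simp add: F_def fop_def)
  qed
  have opB: "op s b \<in> B" if "s \<in> carrier S" for s using b(2) that by auto
  have f_eq: "f u = f v \<longleftrightarrow> u = v" if "u \<in> B" "v \<in> B" for u v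
    using f(1) that by (auto simp: bij_betw_def inj_on_eq_iff)
  have ker: "(q, q') \<in> \<theta> \<longleftrightarrow> (h q, h q') \<in> (\<Union>N. r N)" if "q \<in> F" "q' \<in> F" for q q'
  proof -
    have "(q, q') \<in> \<theta> \<longleftrightarrow> f (op (h q) b) = f (op (h q') b)"
      using that fh eq by (simp add: eq_equiv_class_iff)
    also have "\<dots> \<longleftrightarrow> op (h q) b = op (h q') b"
      using f_eq opB hS that by simp
    finally show ?thesis using ann hS that by auto
  qed
  have "f b \<in> F // \<theta>" using f(1) b(1) by (auto simp: bij_betw_def)
  then obtain q0 where q0: "q0 \<in> F" "f b = \<theta> `` {q0}" by (auto elim: quotientE)
  have "f b = f (op (h q0) b)" using fh q0 by simp
  then have "b = op (h q0) b" using f_eq opB b(1) hS q0(1) by simp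
  then have unit: "(\<one>\<^bsub>S\<^esub>, h q0) \<in> (\<Union>N. r N)"
    using act b(1) hS q0 ann by (auto simp: right_act_def)
  \<comment> \<open>Finitely many pairs of the union lie in one member of the chain.\<close>
  let ?Y = "insert (\<one>\<^bsub>S\<^esub>, h q0) ((\<lambda>(q, q'). (h q, h q')) ` R)"
  have "R \<subseteq> \<theta>" by (auto simp: \<theta>_def generated_act_congruence_def)
  then have "(h q, h q') \<in> (\<Union>N. r N)" if "(q, q') \<in> R" for q q'
    using ker[of q q'] that RF unfolding F_def by blast
  then have "?Y \<subseteq> (\<Union>N. r N)" using unit by (auto simp del: UN_iff)
  moreover have "finite ?Y" using \<open>finite R\<close> by simp
  moreover have "\<exists>N. Y \<subseteq> r N" if "finite Y" "Y \<subseteq> (\<Union>N. r N)" for Y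
    using that
  proof induction
    case (insert z Y)
    then obtain N N' where "z \<in> r N" "Y \<subseteq> r N'" by auto
    then have "insert z Y \<subseteq> r (max N N')"
      using monoD[OF \<open>mono r\<close>, of N "max N N'"] monoD[OF \<open>mono r\<close>, of N' "max N N'"] by auto
    then show ?case by blast
  qed auto
  ultimately obtain N where N1: "(\<one>\<^bsub>S\<^esub>, h q0) \<in> r N"
      and NR: "(\<lambda>(q, q'). (h q, h q')) ` R \<subseteq> r N" by (metis insert_subset)
  have rN: "equiv (carrier S) (r N)"
      and rNcl: "\<And>s a a'. s \<in> carrier S \<Longrightarrow> (a, a') \<in> r N \<Longrightarrow> (a \<otimes>\<^bsub>S\<^esub> s, a' \<otimes>\<^bsub>S\<^esub> s) \<in> r N"
    using r[of N] by (auto simp: act_congruence_def)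
  have hop: "h (fop s q) = h q \<otimes>\<^bsub>S\<^esub> s" if "s \<in> carrier S" "q \<in> F" for s q
    using that c by (auto simp: h_def fop_def F_def m_assoc)
  have fopF: "fop s q \<in> F" if "s \<in> carrier S" "q \<in> F" for s q
    using that by (auto simp: fop_def F_def)
  let ?K = "{(q, q') \<in> F \<times> F. (h q, h q') \<in> r N}"
  have "act_congruence S F fop ?K"
  proof (rule act_congruenceI)
    show "equiv F ?K"
    proof (rule equivI)
      show "refl_on F ?K" using rN hS by (auto simp: equiv_def refl_on_def)
      show "sym ?K" using rN by (auto simp: equiv_def sym_def)
      show "trans ?K" using rN unfolding equiv_def trans_def by blast
    qed auto
  qed (use rNcl hop fopF in auto)
  moreover have "R \<subseteq> ?K" using NR RF by (auto simp: F_def)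
  ultimately have \<theta>K: "\<theta> \<subseteq> ?K" unfolding \<theta>_def generated_act_congruence_def by blast
  have "(s, t) \<in> r N" if st: "(s, t) \<in> (\<Union>N. r N)" for s t
  proof -
    have S: "s \<in> carrier S" "t \<in> carrier S" "op s b = op t b" using st ann by auto
    have "op (h q0 \<otimes>\<^bsub>S\<^esub> s) b = op (h q0 \<otimes>\<^bsub>S\<^esub> t) b"
      using S \<open>b = op (h q0) b\<close> act b(1) hS[OF q0(1)] by (simp add: right_act_def)
    then have "(h q0 \<otimes>\<^bsub>S\<^esub> s, h q0 \<otimes>\<^bsub>S\<^esub> t) \<in> (\<Union>N. r N)" using ann S hS[OF q0(1)] by auto
    then have "(fop s q0, fop t q0) \<in> \<theta>" using ker hop fopF S q0 by simp
    then have "(h q0 \<otimes>\<^bsub>S\<^esub> s, h q0 \<otimes>\<^bsub>S\<^esub> t) \<in> r N" using \<theta>K hop[OF _ q0(1)] S by auto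
    moreover have "(s, h q0 \<otimes>\<^bsub>S\<^esub> s) \<in> r N" "(t, h q0 \<otimes>\<^bsub>S\<^esub> t) \<in> r N"
      using rNcl[OF _ N1] S by fastforce+
    ultimately show ?thesis using rN unfolding equiv_def sym_def trans_def by blast
  qed
  then have "(\<Union>N. r N) = r N" by auto
  then show thesis by (rule that)
qed

text \<open>The annihilator of the class of \<open>a\<close> in \<open>S / \<theta>\<close> determines the cyclic subact generated by
  this class.  Coherency makes that subact finitely presented, because \<open>S / \<theta>\<close> is.\<close>

lemma right_coherent_annihilator_chain:
  fixes S :: "('s, 't) monoid_scheme"
  assumes "monoid S" and coh: "right_coherent S"
    and R: "finite R" "R \<subseteq> carrier S \<times> carrier S" and a: "a \<in> carrier S"
    and \<theta>: "\<theta> = generated_act_congruence S (carrier S) (\<lambda>s t. t \<otimes>\<^bsub>S\<^esub> s) R"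
    and r: "\<And>N. right_congruence S (r N)" and "mono r"
    and ann: "(\<Union>N :: nat. r N) =
      {(s, t) \<in> carrier S \<times> carrier S. (a \<otimes>\<^bsub>S\<^esub> s, a \<otimes>\<^bsub>S\<^esub> t) \<in> \<theta>}"
  obtains N where "(\<Union>N. r N) = r N"
proof -
  interpret monoid S by fact
  \<comment> \<open>\<open>F\<close> is \<open>S\<close> as the free act on the one-element set \<open>{0}\<close>, and \<open>\<theta>'\<close> is \<open>\<theta>\<close> moved to \<open>F\<close>.\<close>
  define F where "F = {0 :: nat} \<times> carrier S"
  define fop where "fop = (\<lambda>s (x :: nat, t). (x, t \<otimes>\<^bsub>S\<^esub> s))"
  define R' where "R' = map_prod (Pair (0 :: nat)) (Pair (0 :: nat)) ` R"
  define \<theta>' where "\<theta>' = generated_act_congruence S F fop R'"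
  have R'F: "R' \<subseteq> F \<times> F" using R by (auto simp: R'_def F_def)
  have fopF: "fop s q \<in> F" if "s \<in> carrier S" "q \<in> F" for s q
    using that by (auto simp: fop_def F_def)
  have act: "right_act S F fop" by (auto simp: right_act_def F_def fop_def m_assoc)
  have cong': "act_congruence S F fop \<theta>'"
    unfolding \<theta>'_def by (rule act_congruence_generated[OF R'F fopF])
  then have eq': "equiv F \<theta>'" by (simp add: act_congruence_def)
  have cong: "right_congruence S \<theta>"
    unfolding \<theta> by (rule act_congruence_generated) (use R in auto)
  then have eq: "equiv (carrier S) \<theta>" by (simp add: act_congruence_def)
  have \<theta>\<theta>': "((0, s), (0, t)) \<in> \<theta>' \<longleftrightarrow> (s, t) \<in> \<theta>" for s t
  proof
    let ?C = "{((0 :: nat, s), (0 :: nat, t)) | s t. (s, t) \<in> \<theta>}"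
    have "act_congruence S F fop ?C"
    proof (rule act_congruenceI)
      show "equiv F ?C"
      proof (rule equivI)
        show "?C \<subseteq> F \<times> F" using eq by (auto simp: equiv_def F_def)
        show "refl_on F ?C" using eq by (auto simp: equiv_def refl_on_def F_def)
        show "sym ?C" using eq by (auto simp: equiv_def sym_def)
        show "trans ?C" using eq unfolding equiv_def trans_def by blast
      qed
    qed (use act_congruenceD[OF cong] in \<open>auto simp: fop_def\<close>)
    moreover have "R' \<subseteq> ?C"
      unfolding R'_def \<theta> generated_act_congruence_def by auto
    ultimately have "\<theta>' \<subseteq> ?C" unfolding \<theta>'_def generated_act_congruence_def by blast
    then show "(s, t) \<in> \<theta>" if "((0, s), (0, t)) \<in> \<theta>'" using that by auto
  next
    let ?D = "{(s, t). ((0, s), (0, t)) \<in> \<theta>'}"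
    have "right_congruence S ?D"
    proof (rule act_congruenceI)
      show "equiv (carrier S) ?D"
      proof (rule equivI)
        show "?D \<subseteq> carrier S \<times> carrier S" using eq' by (auto simp: equiv_def F_def)
        show "refl_on (carrier S) ?D" using eq' by (auto simp: equiv_def refl_on_def F_def)
        show "sym ?D" using eq' by (auto simp: equiv_def sym_def)
        show "trans ?D" using eq' unfolding equiv_def trans_def by blast
      qed
    qed (use act_congruenceD[OF cong'] in \<open>fastforce simp: fop_def\<close>)
    moreover have "R \<subseteq> ?D"
      unfolding R'_def \<theta>'_def generated_act_congruence_def by auto
    ultimately have "\<theta> \<subseteq> ?D" unfolding \<theta> generated_act_congruence_def by blast
    then show "((0, s), (0, t)) \<in> \<theta>'" if "(s, t) \<in> \<theta>" using that by auto
  qed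
  let ?A = "F // \<theta>'" and ?op = "quotient_op \<theta>' fop" and ?b = "\<theta>' `` {(0, a)}"
  have actA: "right_act S ?A ?op" by (rule right_act_quotient[OF assms(1) act cong'])
  have "act_iso S ?A ?op ?A ?op" unfolding act_iso_def by (intro exI[of _ id]) auto
  then have "fin_gen_quotient S ?A ?op F fop"
    unfolding fin_gen_quotient_def Let_def \<theta>'_def
    using R'F R(1) by (intro exI[of _ R']) (auto simp: R'_def)
  then have fpA: "fin_presented_right S ?A ?op"
    unfolding fin_presented_right_def using actA
    by (auto intro!: exI[of _ "{0}"] simp: F_def fop_def)
  have aF: "(0, a) \<in> F" using a by (simp add: F_def)
  then have bA: "?b \<in> ?A" by (rule quotientI)
  let ?B = "generated_subact S ?A ?op {?b}"
  have B: "?B = (\<lambda>s. ?op s ?b) ` carrier S"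
    by (rule generated_subact_singleton[OF assms(1) actA bA])
  have "fin_gen_subact S ?A ?op ?B" unfolding fin_gen_subact_def using bA by blast
  with fpA have fpB: "fin_presented_right S ?B ?op"
    using coh unfolding right_coherent_def by blast
  have bB: "?b \<in> ?B" by (auto simp: generated_subact_def)
  have "?op s ?b = ?op t ?b \<longleftrightarrow> (a \<otimes>\<^bsub>S\<^esub> s, a \<otimes>\<^bsub>S\<^esub> t) \<in> \<theta>"
    if "s \<in> carrier S" "t \<in> carrier S" for s t
  proof -
    have "?op s ?b = \<theta>' `` {(0, a \<otimes>\<^bsub>S\<^esub> s)}" "?op t ?b = \<theta>' `` {(0, a \<otimes>\<^bsub>S\<^esub> t)}"
      using act_congruence_class[OF cong' _ aF] that by (simp_all add: fop_def)
    moreover have "(0, a \<otimes>\<^bsub>S\<^esub> s) \<in> F" "(0, a \<otimes>\<^bsub>S\<^esub> t) \<in> F" using a that by (auto simp: F_def)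
    ultimately show ?thesis using eq' \<theta>\<theta>' by (simp add: eq_equiv_class_iff)
  qed
  then have ann': "(\<Union>N. r N) = {(s, t) \<in> carrier S \<times> carrier S. ?op s ?b = ?op t ?b}"
    unfolding ann by auto
  show thesis
    by (rule fin_presented_right_cyclic_chain[OF assms(1) fpB bB B r \<open>mono r\<close> ann']) (rule that)
qed


section \<open>Shifted idempotents obstruct right coherency\<close>

text \<open>The elements \<open>U k\<close> form a homomorphic image of the integers with identity \<open>U 0\<close>, which may
  differ from the identity of \<open>S\<close>.  The range of \<open>j\<close> in \<open>E_indep\<close> contains the shifts shorter
  than \<open>k\<close>, to which chains of short steps are confined, and the value \<open>- k\<close>, which
  distinguishes the end of a step of length \<open>k\<close> from its start.\<close>

locale shifted_idempotents = monoid S for S (structure) +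
  fixes U :: "int \<Rightarrow> 'a" and g :: 'a and E :: "int \<Rightarrow> 'a"
  defines "E \<equiv> \<lambda>k. U k \<otimes> g \<otimes> U (- k)"
  assumes U_closed [simp]: "U k \<in> carrier S" and U_add: "U k \<otimes> U l = U (k + l)"
    and g_closed [simp]: "g \<in> carrier S" and g_idem: "g \<otimes> g = g"
    and U0_g: "U 0 \<otimes> g = g" and g_U0: "g \<otimes> U 0 = g"
    and E_commute: "E j \<otimes> E k = E k \<otimes> E j"
    and E_indep: "0 < k \<Longrightarrow> - k \<le> j \<Longrightarrow> j < k \<Longrightarrow> j \<noteq> 0 \<Longrightarrow> E j \<otimes> (E 0 \<otimes> E k) \<noteq> E 0 \<otimes> E k"
begin

lemma E_closed [simp]: "E k \<in> carrier S"
  by (simp add: E_def)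

lemma E_0: "E 0 = g"
  by (simp add: E_def U0_g g_U0)

lemma U_U: "y \<in> carrier S \<Longrightarrow> U k \<otimes> (U l \<otimes> y) = U (k + l) \<otimes> y"
  by (simp add: m_assoc[symmetric] U_add)

lemma U0_fixes:
  assumes "y \<in> carrier S" "g \<otimes> y = y"
  shows "U 0 \<otimes> y = y"
  by (metis U0_g U_closed assms g_closed m_assoc)

lemma g_g: "y \<in> carrier S \<Longrightarrow> g \<otimes> (g \<otimes> y) = g \<otimes> y"
  by (simp add: m_assoc[symmetric] g_idem)

text \<open>If \<open>U 0\<close> fixes \<open>s\<close> then the pair \<open>(U 0, U 1)\<close> multiplied by \<open>U k s\<close> identifies \<open>U k s\<close> with
  \<open>U (k + 1) s\<close>; if it does not fix \<open>s\<close> then \<open>s\<close> has no expression to which the pair applies.\<close>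

definition orbit_congruence :: "('a \<times> 'a) set" where
  "orbit_congruence = generated_act_congruence S (carrier S) (\<lambda>s t. t \<otimes> s) {(U 0, U 1)}"

lemma orbit_congruence_iff:
  "(s, t) \<in> orbit_congruence \<longleftrightarrow>
    s \<in> carrier S \<and> t \<in> carrier S \<and> (s = t \<or> U 0 \<otimes> s = s \<and> (\<exists>k. t = U k \<otimes> s))"
proof -
  let ?O = "{(s, t) \<in> carrier S \<times> carrier S. s = t \<or> U 0 \<otimes> s = s \<and> (\<exists>k. t = U k \<otimes> s)}"
  have O1: "right_congruence S ?O"
  proof (rule act_congruenceI)
    show "equiv (carrier S) ?O"
    proof (rule equivI)
      show "sym ?O"
      proof (rule symI)
        fix s t assume st: "(s, t) \<in> ?O"
        have "U 0 \<otimes> t = t \<and> s = U (- k) \<otimes> t" if "U 0 \<otimes> s = s" "t = U k \<otimes> s" for k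
          using that st by (simp add: U_U)
        then show "(t, s) \<in> ?O" using st by blast
      qed
      show "trans ?O"
        by (rule transI) (auto simp: U_U)
    qed (auto simp: refl_on_def)
  next
    fix s a b assume s: "s \<in> carrier S" and ab: "(a, b) \<in> ?O"
    have "U k \<otimes> (y \<otimes> s) = U k \<otimes> y \<otimes> s" if "y \<in> carrier S" for y k
      using that s by (simp add: m_assoc)
    then show "(a \<otimes> s, b \<otimes> s) \<in> ?O"
      using ab s by auto
  qed
  have "{(U 0, U 1)} \<subseteq> ?O" by (auto simp: U_add intro!: exI[of _ 1])
  with O1 have "orbit_congruence \<subseteq> ?O"
    unfolding orbit_congruence_def generated_act_congruence_def by blast
  moreover have "?O \<subseteq> orbit_congruence"
  proof -
    have cong: "right_congruence S orbit_congruence"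
      unfolding orbit_congruence_def by (rule act_congruence_generated) auto
    then have eq: "equiv (carrier S) orbit_congruence" by (simp add: act_congruence_def)
    then have sy: "sym orbit_congruence" and tr: "trans orbit_congruence"
      by (auto simp: equiv_def)
    have U01: "(U 0, U 1) \<in> orbit_congruence"
      by (auto simp: orbit_congruence_def generated_act_congruence_def)
    have "(s, U k \<otimes> s) \<in> orbit_congruence" if s: "s \<in> carrier S" "U 0 \<otimes> s = s" for s k
    proof -
      have step: "(U k \<otimes> s, U (k + 1) \<otimes> s) \<in> orbit_congruence" for k
      proof -
        have "(U 0 \<otimes> (U k \<otimes> s), U 1 \<otimes> (U k \<otimes> s)) \<in> orbit_congruence"
          by (rule act_congruenceD[OF cong _ U01]) (use s in simp)
        then show ?thesis using s by (simp add: U_U add.commute)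
      qed
      show ?thesis
      proof (induction k rule: int_induct[of _ 0])
        case base
        then show ?case using s eq by (simp add: equiv_def refl_on_def)
      next
        case (step1 i)
        from tr step1(2) step[of i] show ?case by (rule transD)
      next
        case (step2 i)
        have "(U (i - 1) \<otimes> s, U i \<otimes> s) \<in> orbit_congruence" using step[of "i - 1"] by simp
        from tr step2(2) symD[OF sy this] show ?case by (rule transD)
      qed
    qed
    then show ?thesis using eq by (auto simp: equiv_def refl_on_def)
  qed
  ultimately have "orbit_congruence = ?O" by blast
  then show ?thesis by auto
qed

definition bounded_step :: "nat \<Rightarrow> ('a \<times> 'a) set" where
  "bounded_step N = {(y, z). y \<in> carrier S \<and> g \<otimes> y = y \<and> g \<otimes> z = z \<and>
     (\<exists>l. \<bar>l\<bar> \<le> int N \<and> z = U l \<otimes> y)}"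

text \<open>The members of the chain of right congruences that exhausts the annihilator of the class of
  \<open>g\<close> modulo \<open>orbit_congruence\<close>.\<close>

definition bounded_annihilator :: "nat \<Rightarrow> ('a \<times> 'a) set" where
  "bounded_annihilator N =
    {(s, t) \<in> carrier S \<times> carrier S. (g \<otimes> s, g \<otimes> t) \<in> (bounded_step N)\<^sup>*}"

lemma bounded_step_sym: "sym (bounded_step N)"
proof (rule symI)
  fix y z assume "(y, z) \<in> bounded_step N"
  then obtain l where l: "y \<in> carrier S" "g \<otimes> y = y" "g \<otimes> z = z" "\<bar>l\<bar> \<le> int N" "z = U l \<otimes> y"
    by (auto simp: bounded_step_def)
  then have "y = U (- l) \<otimes> z" "z \<in> carrier S" using U0_fixes[of y] by (simp_all add: U_U)
  moreover have "\<bar>- l\<bar> \<le> int N" using l(4) by simp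
  ultimately show "(z, y) \<in> bounded_step N"
    using l(2,3) unfolding bounded_step_def by blast
qed

lemma bounded_step_rtrancl_mult:
  assumes "(y, z) \<in> (bounded_step N)\<^sup>*" "s \<in> carrier S"
  shows "(y \<otimes> s, z \<otimes> s) \<in> (bounded_step N)\<^sup>*"
  using assms(1)
proof (induction rule: rtrancl_induct)
  case (step z w)
  have "(z \<otimes> s, w \<otimes> s) \<in> bounded_step N"
    using step(2) assms(2) by (auto simp: bounded_step_def m_assoc[symmetric])
  with step(3) show ?case by (rule rtrancl.rtrancl_into_rtrancl)
qed simp

lemma right_congruence_bounded_annihilator: "right_congruence S (bounded_annihilator N)"
proof (rule act_congruenceI)
  show "equiv (carrier S) (bounded_annihilator N)"
  proof (rule equivI)
    show "sym (bounded_annihilator N)"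
      using sym_rtrancl[OF bounded_step_sym, of N]
      by (auto simp: bounded_annihilator_def sym_def)
    show "trans (bounded_annihilator N)"
      unfolding bounded_annihilator_def trans_def by (auto intro: rtrancl_trans)
  qed (auto simp: bounded_annihilator_def refl_on_def)
qed (auto simp: bounded_annihilator_def m_assoc[symmetric] dest: bounded_step_rtrancl_mult)

lemma bounded_annihilator_mono: "mono bounded_annihilator"
proof (rule monoI)
  fix N N' :: nat assume "N \<le> N'"
  then have "int N \<le> int N'" by (rule of_nat_mono)
  then have "bounded_step N \<subseteq> bounded_step N'"
    unfolding bounded_step_def by (auto; metis order_trans)
  from rtrancl_mono[OF this] show "bounded_annihilator N \<subseteq> bounded_annihilator N'"
    by (auto simp: bounded_annihilator_def)
qed

lemma bounded_annihilator_Union: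
  "(\<Union>N. bounded_annihilator N) =
    {(s, t) \<in> carrier S \<times> carrier S. (g \<otimes> s, g \<otimes> t) \<in> orbit_congruence}"
proof (intro equalityI subsetI)
  fix st assume "st \<in> (\<Union>N. bounded_annihilator N)"
  then obtain N s t where st: "st = (s, t)" "s \<in> carrier S" "t \<in> carrier S"
      "(g \<otimes> s, g \<otimes> t) \<in> (bounded_step N)\<^sup>*"
    by (auto simp: bounded_annihilator_def)
  have "\<exists>k. z = U k \<otimes> (g \<otimes> s)" if "(g \<otimes> s, z) \<in> (bounded_step N)\<^sup>*" for z
    using that
  proof (induction rule: rtrancl_induct)
    case base
    have "g \<otimes> s = U 0 \<otimes> (g \<otimes> s)" using st by (simp add: U0_fixes g_g)
    then show ?case by blast
  next
    case (step y z)
    then show ?case using st by (auto simp: bounded_step_def U_U)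
  qed
  then show "st \<in> {(s, t) \<in> carrier S \<times> carrier S. (g \<otimes> s, g \<otimes> t) \<in> orbit_congruence}"
    using st by (auto simp: orbit_congruence_iff U0_fixes g_g)
next
  fix st assume "st \<in> {(s, t) \<in> carrier S \<times> carrier S. (g \<otimes> s, g \<otimes> t) \<in> orbit_congruence}"
  then obtain s t where st: "st = (s, t)" "s \<in> carrier S" "t \<in> carrier S"
      "g \<otimes> s = g \<otimes> t \<or> (\<exists>k. g \<otimes> t = U k \<otimes> (g \<otimes> s))"
    by (auto simp: orbit_congruence_iff)
  from st(4) show "st \<in> (\<Union>N. bounded_annihilator N)"
  proof
    assume "g \<otimes> s = g \<otimes> t"
    then show ?thesis using st by (auto simp: bounded_annihilator_def)
  next
    assume "\<exists>k. g \<otimes> t = U k \<otimes> (g \<otimes> s)"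
    then obtain k where "g \<otimes> t = U k \<otimes> (g \<otimes> s)" by blast
    moreover from this have "g \<otimes> (U k \<otimes> (g \<otimes> s)) = U k \<otimes> (g \<otimes> s)"
      using st g_g[of t] by simp
    ultimately have "(g \<otimes> s, g \<otimes> t) \<in> bounded_step (nat \<bar>k\<bar>)"
      using st by (auto simp: bounded_step_def g_g)
    then show ?thesis using st by (auto simp: bounded_annihilator_def)
  qed
qed

text \<open>Multiplication by \<open>E (- l) = U (- l) g U l\<close> moves \<open>y\<close> by \<open>U l\<close>, projects to \<open>g S\<close> and
  moves back.\<close>

lemma E_fixes:
  assumes "y \<in> carrier S" "g \<otimes> y = y" "g \<otimes> (U l \<otimes> y) = U l \<otimes> y"
  shows "E (- l) \<otimes> y = y"
proof -
  have "E (- l) \<otimes> y = U (- l) \<otimes> (g \<otimes> (U l \<otimes> y))"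
    using assms(1) by (simp add: E_def m_assoc)
  then show ?thesis using assms by (simp add: U_U U0_fixes)
qed

text \<open>A step from \<open>E 0 E k\<close> by \<open>U l\<close> with \<open>0 < \<bar>l\<bar> < k\<close> would make \<open>E (- l)\<close> fix \<open>E 0 E k\<close>,
  against the independence of the idempotents.\<close>

lemma bounded_step_isolated:
  assumes "int N < k" and "(E 0 \<otimes> E k, z) \<in> (bounded_step N)\<^sup>*"
  shows "z = E 0 \<otimes> E k"
  using assms(2)
proof (induction rule: rtrancl_induct)
  case (step y z)
  then obtain l where l: "g \<otimes> y = y" "g \<otimes> z = z" "\<bar>l\<bar> \<le> int N" "z = U l \<otimes> y"
    by (auto simp: bounded_step_def)
  have "E (- l) \<otimes> (E 0 \<otimes> E k) = E 0 \<otimes> E k"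
    using E_fixes[of y l] l step(3) by simp
  with E_indep[of k "- l"] l(3) assms(1) have "l = 0" by force
  then show ?case using l step(3) U0_fixes by simp
qed simp

text \<open>For \<open>k = N + 1\<close> the elements \<open>g (E k) = E 0 E k\<close> and \<open>g (U (- k) g) = U (- k) (E 0 E k)\<close>
  are related by one step of length \<open>k\<close> but by no chain of steps of length at most \<open>N\<close>.\<close>

theorem not_right_coherent: "\<not> right_coherent S"
proof
  assume "right_coherent S"
  obtain N where N: "(\<Union>N. bounded_annihilator N) = bounded_annihilator N"
    by (rule right_coherent_annihilator_chain[OF monoid_axioms \<open>right_coherent S\<close> _ _ g_closed
      orbit_congruence_def right_congruence_bounded_annihilator bounded_annihilator_mono
      bounded_annihilator_Union]) auto
  define k where "k = int N + 1"
  have k: "0 < k" "int N < k" by (simp_all add: k_def)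
  let ?y = "E 0 \<otimes> E k" and ?z = "g \<otimes> (U (- k) \<otimes> g)"
  have gE: "g \<otimes> E k = ?y" by (simp add: E_0)
  have gy: "g \<otimes> ?y = ?y" by (simp add: E_0 g_g)
  have y: "?y = U k \<otimes> ?z"
    unfolding E_commute[of 0 k] by (simp add: E_0) (simp add: E_def m_assoc)
  have z: "?z = U (- k) \<otimes> ?y"
    unfolding y by (simp add: U_U U0_fixes g_g)
  have "(g \<otimes> E k, ?z) \<in> orbit_congruence"
    unfolding gE orbit_congruence_iff using z gy U0_fixes[OF _ gy] by auto
  then have "(E k, U (- k) \<otimes> g) \<in> bounded_annihilator N"
    using bounded_annihilator_Union unfolding N by simp
  then have "(?y, ?z) \<in> (bounded_step N)\<^sup>*"
    by (simp add: bounded_annihilator_def gE)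
  then have "?z = ?y" by (rule bounded_step_isolated[OF k(2)])
  then have "U k \<otimes> ?y = ?y" using y by simp
  then have "E (- k) \<otimes> ?y = ?y" using E_fixes[of ?y k] gy by simp
  then show False using E_indep[of k "- k"] k(1) by simp
qed

end


section \<open>Left-right duality\<close>

definition opposite_monoid :: "('s, 't) monoid_scheme \<Rightarrow> 's monoid" where
  "opposite_monoid S = \<lparr>carrier = carrier S, monoid.mult = (\<lambda>a b. b \<otimes>\<^bsub>S\<^esub> a), one = \<one>\<^bsub>S\<^esub>\<rparr>"

lemma opposite_monoid_simps [simp]:
  "carrier (opposite_monoid S) = carrier S"
  "a \<otimes>\<^bsub>opposite_monoid S\<^esub> b = b \<otimes>\<^bsub>S\<^esub> a"
  "\<one>\<^bsub>opposite_monoid S\<^esub> = \<one>\<^bsub>S\<^esub>"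
  by (simp_all add: opposite_monoid_def)

lemma monoid_opposite_monoid: "monoid S \<Longrightarrow> monoid (opposite_monoid S)"
  by (rule monoidI) (auto simp: monoid.m_assoc monoid.m_closed monoid.one_closed)

lemma right_act_opposite: "right_act (opposite_monoid S) = left_act S"
  by (auto simp: fun_eq_iff right_act_def left_act_def)

lemma fin_gen_subact_opposite: "fin_gen_subact (opposite_monoid S) = fin_gen_subact S"
  by (simp add: fun_eq_iff fin_gen_subact_def generated_subact_def subact_def)

lemma fin_gen_quotient_opposite: "fin_gen_quotient (opposite_monoid S) = fin_gen_quotient S"
  by (simp add: fun_eq_iff fin_gen_quotient_def generated_act_congruence_def act_congruence_def
      act_iso_def)

lemma fin_presented_right_opposite:
  "fin_presented_right (opposite_monoid S) = fin_presented_left S"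
  by (simp add: fun_eq_iff fin_presented_right_def fin_presented_left_def right_act_opposite
      fin_gen_quotient_opposite)

lemma right_coherent_opposite: "right_coherent (opposite_monoid S) = left_coherent S"
  by (simp add: right_coherent_def left_coherent_def fin_presented_right_opposite
      fin_gen_subact_opposite)

context shifted_idempotents
begin

text \<open>Reversing the products turns \<open>U k g U (- k)\<close> into \<open>U (- k) g U k\<close>, so the sign change in
  \<open>U\<close> keeps every \<open>E k\<close> the same, and the conditions on the \<open>E k\<close> are invariant under reversal
  because they commute.\<close>

lemma shifted_idempotents_opposite:
  "shifted_idempotents (opposite_monoid S) (\<lambda>k. U (- k)) g"
proof -
  have E': "U k \<otimes> (g \<otimes> U (- k)) = E k" for k
    by (simp add: E_def m_assoc)
  have indep: "E k \<otimes> (g \<otimes> E j) \<noteq> E k \<otimes> g"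
    if "0 < k" "- k \<le> j" "j < k" "j \<noteq> 0" for j k
  proof -
    have "E k \<otimes> (E 0 \<otimes> E j) = E j \<otimes> (E 0 \<otimes> E k)"
      by (metis E_closed E_commute m_assoc)
    then show ?thesis using E_indep[OF that] by (simp add: E_commute[of 0 k] flip: E_0)
  qed
  interpret opp: monoid "opposite_monoid S"
    by (rule monoid_opposite_monoid[OF monoid_axioms])
  show ?thesis
    by unfold_locales
      (use E_commute indep in \<open>auto simp: E' E_0 U_add g_idem U0_g g_U0 add.commute m_assoc\<close>)
qed

theorem not_left_coherent: "\<not> left_coherent S"
  using shifted_idempotents.not_right_coherent[OF shifted_idempotents_opposite]
  by (simp add: right_coherent_opposite)

end


section \<open>Quotients of the monoid S(M)\<close>

lemma quotient_monoid_mult: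
  assumes "monoid_congruence P \<rho>" "a \<in> carrier P" "b \<in> carrier P"
  shows "\<rho> `` {a} \<otimes>\<^bsub>quotient_monoid P \<rho>\<^esub> \<rho> `` {b} = \<rho> `` {a \<otimes>\<^bsub>P\<^esub> b}"
proof -
  have eq: "equiv (carrier P) \<rho>"
    and cl: "\<And>u v u' v'. (u, u') \<in> \<rho> \<Longrightarrow> (v, v') \<in> \<rho> \<Longrightarrow> (u \<otimes>\<^bsub>P\<^esub> v, u' \<otimes>\<^bsub>P\<^esub> v') \<in> \<rho>"
    using assms unfolding monoid_congruence_def by auto
  have aa: "(a, a) \<in> \<rho>" "(b, b) \<in> \<rho>" using eq assms by (simp_all add: equiv_def refl_on_def)
  have "z \<in> \<rho> `` {a} \<otimes>\<^bsub>quotient_monoid P \<rho>\<^esub> \<rho> `` {b} \<longleftrightarrow> z \<in> \<rho> `` {a \<otimes>\<^bsub>P\<^esub> b}" for z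
  proof -
    have "(u \<otimes>\<^bsub>P\<^esub> v, z) \<in> \<rho> \<longleftrightarrow> (a \<otimes>\<^bsub>P\<^esub> b, z) \<in> \<rho>" if "(a, u) \<in> \<rho>" "(b, v) \<in> \<rho>" for u v
      using cl[OF that] eq unfolding equiv_def sym_def trans_def by blast
    moreover have "z \<in> \<rho> `` {a} \<otimes>\<^bsub>quotient_monoid P \<rho>\<^esub> \<rho> `` {b} \<longleftrightarrow>
        (\<exists>u v. (a, u) \<in> \<rho> \<and> (b, v) \<in> \<rho> \<and> (u \<otimes>\<^bsub>P\<^esub> v, z) \<in> \<rho>)"
      by (auto simp: quotient_monoid_def set_mult_def)
    ultimately show ?thesis using aa by blast
  qed
  then show ?thesis by blast
qed

theorem corollary3p8:
  fixes M :: "('a, 'm) monoid_scheme" and H :: "'a set" and e x :: 'a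
    and G :: "('a, 'm) monoid_scheme" and p :: "int \<Rightarrow> 'a"
    and \<rho> :: "(('a set \<times> 'a) \<times> ('a set \<times> 'a)) set"
    and S :: "('s, 't) monoid_scheme" and f :: "('a set \<times> 'a) set \<Rightarrow> 's"
  assumes "monoid M"
    and "H \<subseteq> carrier M" and "G = M\<lparr>carrier := H, one := e\<rparr>" and "group G"
    and "x \<in> H" and "p = (\<lambda>k. x [^]\<^bsub>G\<^esub> k)" and "H = {p k | k. True}" and "G \<cong> integer_group"
    and "monoid_congruence (power_semidirect M) \<rho>"
    and "\<forall>m n. m \<noteq> n \<longrightarrow> (({p m}, p 0), ({p n}, p 0)) \<notin> \<rho>"
    and "\<forall>m n. 0 < m \<and> 0 < n \<longrightarrow>
      (({p m, p (- n)}, p 0), ({p m}, p 0)) \<notin> \<rho> \<and>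
      (({p m, p (- n)}, p 0), ({p (- n)}, p 0)) \<notin> \<rho>"
    and "\<forall>m n. 0 \<le> m \<and> 0 \<le> n \<and> m \<noteq> n \<longrightarrow>
      (({p m, p n}, p 0), ({p m}, p 0)) \<notin> \<rho> \<and>
      (({p (- m), p (- n)}, p 0), ({p (- m)}, p 0)) \<notin> \<rho>"
    and "\<forall>k n. 0 < k \<and> k < n \<longrightarrow>
      (({p 0, p n}, p 0), ({p k}, p 0)) \<notin> \<rho> \<and>
      (({p 0, p n}, p 0), ({p 0, p k, p n}, p 0)) \<notin> \<rho>"
    and "\<forall>k n. 0 < k \<and> k \<le> n \<longrightarrow>
      (({p 0, p n}, p 0), ({p (- k)}, p 0)) \<notin> \<rho> \<and>
      (({p 0, p n}, p 0), ({p (- k), p 0, p n}, p 0)) \<notin> \<rho>"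
    and "monoid S"
    and "f \<in> mon (quotient_monoid (power_semidirect M) \<rho>) S"
  shows "\<not> right_coherent S \<and> \<not> left_coherent S"
proof -
  let ?P = "power_semidirect M" and ?Q = "quotient_monoid (power_semidirect M) \<rho>"
  interpret S: monoid S by fact
  interpret G: group G by fact
  have pM: "p k \<in> carrier M" for k using assms(2,7) by auto
  have padd: "p k \<otimes>\<^bsub>M\<^esub> p l = p (k + l)" for k l
    using G.int_pow_mult[of x k l] assms(3,5,6) by simp
  \<comment> \<open>\<open>\<phi>\<close> transports the part of \<open>\<S>(M)\<close> over the infinite cyclic subgroup to \<open>S\<close>, with
    elements written in exponents.\<close>
  define \<phi> where "\<phi> A k = f (\<rho> `` {(p ` A, p k)})" for A k
  have PA: "(p ` A, p k) \<in> carrier ?P" for A k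
    using pM by (auto simp: power_semidirect_def)
  have QA: "\<rho> `` {(p ` A, p k)} \<in> carrier ?Q" for A k
    using PA by (auto simp: quotient_monoid_def intro: quotientI)
  have f: "f \<in> hom ?Q S" "inj_on f (carrier ?Q)" using assms(16) by (auto simp: mon_def)
  have \<phi>S: "\<phi> A k \<in> carrier S" for A k
    unfolding \<phi>_def using hom_in_carrier[OF f(1) QA] .
  have \<phi>mult: "\<phi> A k \<otimes>\<^bsub>S\<^esub> \<phi> B l = \<phi> (A \<union> (+) k ` B) (k + l)" for A B k l
  proof -
    have "(p ` A, p k) \<otimes>\<^bsub>?P\<^esub> (p ` B, p l) = (p ` (A \<union> (+) k ` B), p (k + l))"
      by (auto simp: power_semidirect_def l_coset_def padd)
    then show ?thesis
      unfolding \<phi>_def hom_mult[OF f(1) QA QA, symmetric]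
      by (simp add: quotient_monoid_mult[OF assms(9) PA PA])
  qed
  have \<phi>eq: "((p ` A, p k), (p ` B, p l)) \<in> \<rho>" if "\<phi> A k = \<phi> B l" for A B k l
  proof -
    have "\<rho> `` {(p ` A, p k)} = \<rho> `` {(p ` B, p l)}"
      using that QA f(2) by (auto simp: \<phi>_def inj_on_def)
    moreover have "equiv (carrier ?P) \<rho>" using assms(9) by (simp add: monoid_congruence_def)
    ultimately show ?thesis using PA by (simp add: eq_equiv_class_iff)
  qed
  define U where "U = \<phi> {}"
  define g where "g = \<phi> {0} 0"
  have E: "U k \<otimes>\<^bsub>S\<^esub> g \<otimes>\<^bsub>S\<^esub> U (- k) = \<phi> {k} 0" for k
    by (simp add: U_def g_def \<phi>mult)
  let ?E = "\<lambda>k. U k \<otimes>\<^bsub>S\<^esub> g \<otimes>\<^bsub>S\<^esub> U (- k)"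
  interpret shifted_idempotents S U g ?E
  proof unfold_locales
    fix j k :: int assume k: "0 < k" and j: "- k \<le> j" "j < k" "j \<noteq> 0"
    show "?E j \<otimes>\<^bsub>S\<^esub> (?E 0 \<otimes>\<^bsub>S\<^esub> ?E k) \<noteq> ?E 0 \<otimes>\<^bsub>S\<^esub> ?E k"
    proof
      assume "?E j \<otimes>\<^bsub>S\<^esub> (?E 0 \<otimes>\<^bsub>S\<^esub> ?E k) = ?E 0 \<otimes>\<^bsub>S\<^esub> ?E k"
      then have "\<phi> {j, 0, k} 0 = \<phi> {0, k} 0"
        unfolding E by (simp add: \<phi>mult insert_commute)
      from \<phi>eq[OF this[symmetric]] have *: "(({p 0, p k}, p 0), ({p j, p 0, p k}, p 0)) \<in> \<rho>" by simp
      show False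
      proof (cases "0 < j")
        case True
        with * assms(13) j show False by (auto simp: insert_commute)
      next
        case False
        with j have "0 < - j \<and> - j \<le> k" by simp
        with assms(14) have "(({p 0, p k}, p 0), ({p (- (- j)), p 0, p k}, p 0)) \<notin> \<rho>" by blast
        with * show False by simp
      qed
    qed
  qed (unfold E, simp_all add: U_def g_def \<phi>mult \<phi>S insert_commute)
  show ?thesis using not_right_coherent not_left_coherent by simp
qed

end
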